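(* Let $V$ be a finite set, let $\mathcal{C}\subseteq 2^V$ be a nontrivial Sperner hypergraph, and let $h=\Phi_{\mathcal{C}}$ be the hypergraph Horn function represented by the circular CNF of $\mathcal{C}$. Then the following are equivalent: (i) $\mathcal{C}$ satisfies the circuit axiom (C3): if $C_1,C_2\in\mathcal{C}$ are distinct and $u\in C_1\cap C_2$, then there exists $C_3\in\mathcal{C}$ with $C_3\subseteq (C_1\cup C_2)\setminus\{u\}$; (ii) $\mathcal{K}(h)=\mathcal{C}^{dc}$; (iii) $\mathcal{M}(h)=\mathcal{C}^{dcdc}$; (iv) $\mathcal{T}(h)=\left(\mathcal{C}^{dcdc}\right)^{\cap}$.
   Context: Boolean functions $f:\{0,1\}^V\to\{0,1\}$ are viewed as functions on subsets of $V$ via characteristic vectors; $\mathcal{T}(f)$ is the family of true sets ($f(Z)=1$). For $B\subseteq V$ and $v\in V\setminus B$, the definite Horn clause (implication) $B\to v$ is the function whose true sets are exactly the $T\subseteq V$ with $B\not\subseteq T$ or $B\cup\{v\}\subseteq T$. A definite Horn function is a conjunction of such clauses; its true sets are closed under intersection and contain $V$, and $\mathbb{T}_h(Z)$ denotes the smallest true set of $h$ containing $Z$. For a hypergraph $\mathcal{H}\subseteq 2^V$, the circular CNF is $\Phi_{\mathcal{H}}=\bigwedge_{H\in\mathcal{H}}\bigwedge_{v\in H}\big((H\setminus\{v\})\to v\big)$. $\mathcal{K}(h)$ is the family of inclusion-minimal sets $K$ with $\mathbb{T}_h(K)=V$ (minimal keys); $\mathcal{M}(h)$ is the family of inclusion-maximal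 true sets of $h$ different from $V$. For a hypergraph $\mathcal{H}$: $\mathcal{H}^c=\{V\setminus H: H\in\mathcal{H}\}$; $\mathcal{H}^d$ is the family of inclusion-minimal transversals (sets meeting every hyperedge) of $\mathcal{H}$; operators are composed left to right, e.g. $\mathcal{H}^{dc}=(\mathcal{H}^d)^c$, $\mathcal{H}^{dcdc}=(((\mathcal{H}^d)^c)^d)^c$; $\mathcal{H}^\cap$ is the family of all intersections of subfamilies of $\mathcal{H}$, the intersection of the empty subfamily being $V$. A hypergraph is Sperner if no hyperedge contains another distinct hyperedge; nontrivial means here that $\mathcal{C}$ is nonempty and $\emptyset\notin\mathcal{C}$. *)

theory Defs
  imports Main
begin

text \<open>
  A Boolean function on \<open>{0,1}\<^sup>V\<close> is represented by a predicate on sets, a 0-1 vector being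
  identified with its support; the ground set \<open>V\<close> is an explicit parameter, and the values of the
  predicate on sets that are not contained in \<open>V\<close> are irrelevant.
\<close>

type_synonym 'a boolean_function = "'a set \<Rightarrow> bool"

type_synonym 'a hypergraph = "'a set set"

definition true_sets :: "'a set \<Rightarrow> 'a boolean_function \<Rightarrow> 'a set set" where
  "true_sets V f = {Z. Z \<subseteq> V \<and> f Z}"

definition implication :: "'a set \<Rightarrow> 'a \<Rightarrow> 'a boolean_function" where
  "implication B v T \<longleftrightarrow> \<not> B \<subseteq> T \<or> B \<union> {v} \<subseteq> T"

definition circular_cnf :: "'a hypergraph \<Rightarrow> 'a boolean_function" where
  "circular_cnf \<H> T \<longleftrightarrow> (\<forall>H\<in>\<H>. \<forall>v\<in>H. implication (H - {v}) v T)"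

definition minimal_sets :: "'a set set \<Rightarrow> 'a set set" where
  "minimal_sets \<F> = {X \<in> \<F>. \<forall>Y\<in>\<F>. Y \<subseteq> X \<longrightarrow> Y = X}"

definition maximal_sets :: "'a set set \<Rightarrow> 'a set set" where
  "maximal_sets \<F> = {X \<in> \<F>. \<forall>Y\<in>\<F>. X \<subseteq> Y \<longrightarrow> Y = X}"

text \<open>
  The least element below is with respect to inclusion. It exists for \<open>Z \<subseteq> V\<close> whenever the true
  sets of \<open>h\<close> contain \<open>V\<close> and are closed under intersection, as is the case for definite Horn
  functions.
\<close>

definition horn_closure :: "'a set \<Rightarrow> 'a boolean_function \<Rightarrow> 'a set \<Rightarrow> 'a set" where
  "horn_closure V h Z = (LEAST T. T \<in> true_sets V h \<and> Z \<subseteq> T)"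

definition minimal_keys :: "'a set \<Rightarrow> 'a boolean_function \<Rightarrow> 'a set set" where
  "minimal_keys V h = minimal_sets {K. K \<subseteq> V \<and> horn_closure V h K = V}"

definition maximal_proper_true_sets :: "'a set \<Rightarrow> 'a boolean_function \<Rightarrow> 'a set set" where
  "maximal_proper_true_sets V h = maximal_sets (true_sets V h - {V})"

definition hyp_compl :: "'a set \<Rightarrow> 'a hypergraph \<Rightarrow> 'a hypergraph" where
  "hyp_compl V \<H> = {V - H | H. H \<in> \<H>}"

definition hyp_dual :: "'a set \<Rightarrow> 'a hypergraph \<Rightarrow> 'a hypergraph" where
  "hyp_dual V \<H> = minimal_sets {T. T \<subseteq> V \<and> (\<forall>H\<in>\<H>. T \<inter> H \<noteq> {})}"

text \<open>
  The intersection with \<open>V\<close> only matters for the empty subfamily, where \<open>\<Inter>{}\<close> is \<open>UNIV\<close>.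
\<close>

definition hyp_inters :: "'a set \<Rightarrow> 'a hypergraph \<Rightarrow> 'a hypergraph" where
  "hyp_inters V \<H> = {V \<inter> \<Inter>\<S> | \<S>. \<S> \<subseteq> \<H>}"

definition sperner :: "'a hypergraph \<Rightarrow> bool" where
  "sperner \<H> \<longleftrightarrow> (\<forall>H\<in>\<H>. \<forall>H'\<in>\<H>. H \<subseteq> H' \<longrightarrow> H = H')"

definition nontrivial :: "'a hypergraph \<Rightarrow> bool" where
  "nontrivial \<H> \<longleftrightarrow> \<H> \<noteq> {} \<and> {} \<notin> \<H>"

definition circuit_elimination :: "'a hypergraph \<Rightarrow> bool" where
  "circuit_elimination \<C> \<longleftrightarrow>
     (\<forall>C1\<in>\<C>. \<forall>C2\<in>\<C>. C1 \<noteq> C2 \<longrightarrow>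
        (\<forall>u \<in> C1 \<inter> C2. \<exists>C3\<in>\<C>. C3 \<subseteq> (C1 \<union> C2) - {u}))"

end

theory Submission
  imports Defs
begin

text \<open>
  \<open>\<C>\<^sup>d\<^sup>c\<close> consists of the maximal sets containing no member of \<open>\<C>\<close> (the bases), and
  \<open>\<M>(h) = \<K>(h)\<^sup>d\<^sup>c\<close> always holds. Since \<open>dc\<close> is injective on Sperner hypergraphs, this
  gives the equivalence of (ii) and (iii). Every basis spans, so (ii) says that no basis can lose an
  element and still span. Under the circuit axiom, strong elimination shows that the matroid closure
  of a basis minus an element \<open>b\<close> is a true set missing \<open>b\<close>. Conversely, if \<open>(C\<^sub>1 \<union> C\<^sub>2) - {u}\<close>
  contained no circuit, a basis extending it could lose any element of \<open>C\<^sub>1 - C\<^sub>2\<close> and still span.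
  For (iv), given a true set \<open>T\<close> and \<open>v \<notin> T\<close>, extend a maximal independent subset \<open>I\<close> of \<open>T\<close>
  together with \<open>v\<close> to a basis \<open>B\<close>; a maximal true set above \<open>B - {v}\<close> contains \<open>T\<close> and misses \<open>v\<close>.
\<close>

section \<open>Extremal sets and duals\<close>

lemma maximal_sets_above:
  assumes "finite \<F>" "X \<in> \<F>"
  obtains Y where "Y \<in> maximal_sets \<F>" "X \<subseteq> Y"
proof -
  obtain Y where "Y \<in> \<F>" "X \<subseteq> Y" "\<forall>Z\<in>\<F>. Y \<subseteq> Z \<longrightarrow> Y = Z"
    using finite_has_maximal2[OF assms] by metis
  then show ?thesis by (intro that[of Y]) (auto simp: maximal_sets_def)
qed

lemma minimal_sets_below:
  assumes "finite \<F>" "X \<in> \<F>"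
  obtains Y where "Y \<in> minimal_sets \<F>" "Y \<subseteq> X"
proof -
  obtain Y where "Y \<in> \<F>" "Y \<subseteq> X" "\<forall>Z\<in>\<F>. Z \<subseteq> Y \<longrightarrow> Y = Z"
    using finite_has_minimal2[OF assms] by metis
  then show ?thesis by (intro that[of Y]) (auto simp: minimal_sets_def)
qed

text \<open>Every member of \<open>\<G>\<close> lies below a member of \<open>\<F>\<close>, so
  nothing in \<open>\<G>\<close> can strictly exceed a maximal member of \<open>\<F>\<close>.
  Applied below with the proper true sets as \<open>\<F>\<close> and their subsets as
  \<open>\<G>\<close>.\<close>

lemma maximal_sets_cofinal:
  assumes "\<F> \<subseteq> \<G>" and cofinal: "\<And>S. S \<in> \<G> \<Longrightarrow> \<exists>T\<in>\<F>. S \<subseteq> T"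
  shows "maximal_sets \<F> = maximal_sets \<G>"
proof (rule set_eqI, rule iffI)
  fix X assume "X \<in> maximal_sets \<F>"
  then have X: "X \<in> \<F>" and max: "\<And>Y. Y \<in> \<F> \<Longrightarrow> X \<subseteq> Y \<Longrightarrow> Y = X"
    unfolding maximal_sets_def by blast+
  have "Y = X" if Y: "Y \<in> \<G>" "X \<subseteq> Y" for Y
  proof -
    obtain T where "T \<in> \<F>" "Y \<subseteq> T" using cofinal[OF Y(1)] by blast
    moreover from this have "T = X" using max Y(2) by (meson subset_trans)
    ultimately show ?thesis using Y(2) by blast
  qed
  then show "X \<in> maximal_sets \<G>"
    using X assms(1) unfolding maximal_sets_def by blast
next
  fix X assume "X \<in> maximal_sets \<G>"
  then have X: "X \<in> \<G>" and max: "\<And>Y. Y \<in> \<G> \<Longrightarrow> X \<subseteq> Y \<Longrightarrow> Y = X"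
    unfolding maximal_sets_def by blast+
  obtain T where T: "T \<in> \<F>" "X \<subseteq> T" using cofinal[OF X] by blast
  then have "T = X" using max assms(1) by blast
  then have "X \<in> \<F>" using T by simp
  then show "X \<in> maximal_sets \<F>"
    using max assms(1) unfolding maximal_sets_def by blast
qed

lemma sperner_minimal_sets: "sperner (minimal_sets \<F>)"
  unfolding sperner_def minimal_sets_def by blast

lemma sperner_maximal_sets: "sperner (maximal_sets \<F>)"
  unfolding sperner_def maximal_sets_def by blast

text \<open>Complementation in \<open>V\<close> reverses inclusion and exchanges meeting every
  hyperedge with containing no hyperedge, so minimal transversals become maximal sets.\<close>

lemma hyp_compl_hyp_dual:
  "hyp_compl V (hyp_dual V \<H>) = maximal_sets {S. S \<subseteq> V \<and> (\<forall>A\<in>\<H>. \<not> A \<subseteq> S)}"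
  if "\<H> \<subseteq> Pow V"
proof -
  let ?T = "{T. T \<subseteq> V \<and> (\<forall>H\<in>\<H>. T \<inter> H \<noteq> {})}"
  let ?S = "{S. S \<subseteq> V \<and> (\<forall>A\<in>\<H>. \<not> A \<subseteq> S)}"
  have TS: "V - T \<in> ?S" if "T \<in> ?T" for T
    using that by blast
  have ST: "V - S \<in> ?T" if "S \<in> ?S" for S
    using that \<open>\<H> \<subseteq> Pow V\<close> by blast
  show ?thesis
  proof (rule set_eqI, rule iffI)
    fix X assume "X \<in> hyp_compl V (hyp_dual V \<H>)"
    then obtain T where "T \<in> minimal_sets ?T" and T1: "X = V - T"
      unfolding hyp_compl_def hyp_dual_def by auto
    then have T2: "T \<in> ?T" and min: "\<And>Y. Y \<in> ?T \<Longrightarrow> Y \<subseteq> T \<Longrightarrow> Y = T"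
      unfolding minimal_sets_def by blast+
    note T = T1 T2
    have "Y = X" if "Y \<in> ?S" "X \<subseteq> Y" for Y
    proof -
      have "V - Y = T"
        using min[OF ST[OF that(1)]] T that(2) by blast
      then show ?thesis using that(1) T(1) by blast
    qed
    then show "X \<in> maximal_sets ?S"
      using TS[OF T(2)] T(1) unfolding maximal_sets_def by blast
  next
    fix X assume X: "X \<in> maximal_sets ?S"
    then have XS: "X \<in> ?S" and max: "\<And>Y. Y \<in> ?S \<Longrightarrow> X \<subseteq> Y \<Longrightarrow> Y = X"
      unfolding maximal_sets_def by blast+
    have "Y = V - X" if "Y \<in> ?T" "Y \<subseteq> V - X" for Y
    proof -
      have "V - Y = X"
        using max[OF TS[OF that(1)]] XS that(2) by blast
      then show ?thesis using that(1) by blast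
    qed
    then have "V - X \<in> hyp_dual V \<H>"
      using ST[OF XS] unfolding hyp_dual_def minimal_sets_def by blast
    moreover have "X = V - (V - X)" using XS by blast
    ultimately show "X \<in> hyp_compl V (hyp_dual V \<H>)"
      unfolding hyp_compl_def by blast
  qed
qed

text \<open>A subset of \<open>V\<close> contains a hyperedge iff it lies below none of the maximal
  hyperedge-free sets. These therefore determine the up-set generated by the hypergraph, and a
  Sperner hypergraph consists of the minimal members of its up-set.\<close>

lemma hyp_compl_hyp_dual_inject:
  assumes V: "finite V" and "\<F> \<subseteq> Pow V" "\<G> \<subseteq> Pow V" "sperner \<F>" "sperner \<G>"
    and eq: "hyp_compl V (hyp_dual V \<F>) = hyp_compl V (hyp_dual V \<G>)"
  shows "\<F> = \<G>"
proof -
  have dense: "(\<exists>A\<in>\<H>. A \<subseteq> S) \<longleftrightarrow> \<not> (\<exists>M\<in>hyp_compl V (hyp_dual V \<H>). S \<subseteq> M)"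
    if H: "\<H> \<subseteq> Pow V" and S: "S \<subseteq> V" for \<H> S
  proof
    assume A: "\<exists>A\<in>\<H>. A \<subseteq> S"
    have "\<forall>A\<in>\<H>. \<not> A \<subseteq> M" if "M \<in> hyp_compl V (hyp_dual V \<H>)" for M
      using that unfolding hyp_compl_hyp_dual[OF H] maximal_sets_def by blast
    then show "\<not> (\<exists>M\<in>hyp_compl V (hyp_dual V \<H>). S \<subseteq> M)"
      using A by (meson subset_trans)
  next
    assume none: "\<not> (\<exists>M\<in>hyp_compl V (hyp_dual V \<H>). S \<subseteq> M)"
    show "\<exists>A\<in>\<H>. A \<subseteq> S"
    proof (rule ccontr)
      assume "\<not> (\<exists>A\<in>\<H>. A \<subseteq> S)"
      then have SM: "S \<in> {S. S \<subseteq> V \<and> (\<forall>A\<in>\<H>. \<not> A \<subseteq> S)}" using S by blast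
      have "finite {S. S \<subseteq> V \<and> (\<forall>A\<in>\<H>. \<not> A \<subseteq> S)}"
        using V by simp
      from this SM obtain M where "M \<in> hyp_compl V (hyp_dual V \<H>)" "S \<subseteq> M"
        unfolding hyp_compl_hyp_dual[OF H] by (rule maximal_sets_above)
      then show False using none by blast
    qed
  qed
  have same: "(\<exists>A\<in>\<F>. A \<subseteq> S) \<longleftrightarrow> (\<exists>A\<in>\<G>. A \<subseteq> S)" if "S \<subseteq> V" for S
    using dense[OF assms(2) that] dense[OF assms(3) that] eq by simp
  \<comment> \<open>Descend from \<open>X\<close> to some \<open>A\<close> in \<open>\<H>'\<close>
    and from there to some \<open>B\<close> in \<open>\<H>\<close>; the Sperner property gives
    \<open>B = X\<close>, which squeezes \<open>A\<close>.\<close>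
  have "X \<in> \<H>'"
    if X: "X \<in> \<H>" and H: "\<H> \<subseteq> Pow V" "\<H>' \<subseteq> Pow V" and "sperner \<H>"
      and same: "\<And>S. S \<subseteq> V \<Longrightarrow> (\<exists>A\<in>\<H>. A \<subseteq> S) \<longleftrightarrow> (\<exists>A\<in>\<H>'. A \<subseteq> S)" for X \<H> \<H>'
  proof -
    obtain A where A: "A \<in> \<H>'" "A \<subseteq> X" using same[of X] X H by blast
    moreover have "A \<subseteq> V" using A H by blast
    ultimately obtain B where "B \<in> \<H>" "B \<subseteq> A" using same[of A] by blast
    then have "B = X" using A X \<open>sperner \<H>\<close> unfolding sperner_def by (meson subset_trans)
    then have "A = X" using A \<open>B \<subseteq> A\<close> by blast
    then show ?thesis using A by simp
  qed
  note sub = this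
  show ?thesis
  proof (rule subset_antisym; rule subsetI)
    show "X \<in> \<G>" if "X \<in> \<F>" for X
      using sub[OF that assms(2,3,4)] same by simp
    show "X \<in> \<F>" if "X \<in> \<G>" for X
      using sub[OF that assms(3,2,5)] same by simp
  qed
qed

text \<open>An intersection different from \<open>V\<close> comes from a nonempty subfamily and so
  lies below a member of \<open>\<D>\<close>. This lets the maximal proper true sets be read off a
  description of all true sets as intersections.\<close>

lemma maximal_sets_hyp_inters:
  assumes "sperner \<D>" "\<D> \<subseteq> Pow V" "V \<notin> \<D>"
  shows "maximal_sets (hyp_inters V \<D> - {V}) = \<D>"
proof -
  have below: "\<exists>D\<in>\<D>. X \<subseteq> D" if X: "X \<in> hyp_inters V \<D> - {V}" for X
  proof -
    obtain \<S> where S: "X = V \<inter> \<Inter>\<S>" "\<S> \<subseteq> \<D>" using X unfolding hyp_inters_def by blast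
    then have "\<S> \<noteq> {}" using X by auto
    then show ?thesis using S by blast
  qed
  have mem: "D \<in> hyp_inters V \<D> - {V}" if "D \<in> \<D>" for D
  proof -
    have "D = V \<inter> \<Inter>{D}" using that assms(2) by auto
    then have "D \<in> hyp_inters V \<D>" using that unfolding hyp_inters_def by blast
    then show ?thesis using that assms(3) by blast
  qed
  show ?thesis
  proof (rule set_eqI, rule iffI)
    fix X assume "X \<in> maximal_sets (hyp_inters V \<D> - {V})"
    then have X: "X \<in> hyp_inters V \<D> - {V}"
      and max: "\<And>Y. Y \<in> hyp_inters V \<D> - {V} \<Longrightarrow> X \<subseteq> Y \<Longrightarrow> Y = X"
      unfolding maximal_sets_def by blast+
    obtain D where D: "D \<in> \<D>" "X \<subseteq> D" using below[OF X] by blast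
    then have "D = X" using max[OF mem] by simp
    then show "X \<in> \<D>" using D by simp
  next
    fix D assume D: "D \<in> \<D>"
    have "Y = D" if Y: "Y \<in> hyp_inters V \<D> - {V}" "D \<subseteq> Y" for Y
    proof -
      obtain D' where D': "D' \<in> \<D>" "Y \<subseteq> D'" using below[OF Y(1)] by blast
      then have "D = D'" using Y(2) D assms(1) unfolding sperner_def by (meson subset_trans)
      then show ?thesis using Y(2) D' by blast
    qed
    then show "D \<in> maximal_sets (hyp_inters V \<D> - {V})"
      using mem[OF D] unfolding maximal_sets_def by blast
  qed
qed

section \<open>Closure and keys of a circular CNF\<close>

lemma true_sets_circular_cnf:
  "true_sets V (circular_cnf \<C>) = {T. T \<subseteq> V \<and> (\<forall>C\<in>\<C>. \<forall>v\<in>C. C - {v} \<subseteq> T \<longrightarrow> v \<in> T)}"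
  unfolding true_sets_def circular_cnf_def implication_def by blast

lemma Inter_true_sets:
  assumes "\<S> \<subseteq> true_sets V (circular_cnf \<C>)" "\<S> \<noteq> {}"
  shows "\<Inter>\<S> \<in> true_sets V (circular_cnf \<C>)"
  using assms unfolding true_sets_circular_cnf by blast

lemma ground_true_set:
  "\<C> \<subseteq> Pow V \<Longrightarrow> V \<in> true_sets V (circular_cnf \<C>)"
  unfolding true_sets_circular_cnf by blast

text \<open>The condition that the Horn closure of \<open>S\<close> is \<open>V\<close>, phrased
  without \<open>LEAST\<close>.\<close>

definition spanning :: "'a set \<Rightarrow> 'a hypergraph \<Rightarrow> 'a set \<Rightarrow> bool" where
  "spanning V \<C> S \<longleftrightarrow> S \<subseteq> V \<and> (\<forall>T\<in>true_sets V (circular_cnf \<C>). S \<subseteq> T \<longrightarrow> T = V)"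

text \<open>The closure of \<open>K\<close> is the intersection of all true sets above
  \<open>K\<close>, and that intersection is \<open>V\<close> exactly when \<open>V\<close> is the
  only such set.\<close>

lemma minimal_keys_circular_cnf:
  assumes "\<C> \<subseteq> Pow V"
  shows "minimal_keys V (circular_cnf \<C>) = minimal_sets (Collect (spanning V \<C>))"
proof -
  have "horn_closure V (circular_cnf \<C>) K = V \<longleftrightarrow>
      (\<forall>T\<in>true_sets V (circular_cnf \<C>). K \<subseteq> T \<longrightarrow> T = V)" if K: "K \<subseteq> V" for K
  proof -
    let ?S = "{T \<in> true_sets V (circular_cnf \<C>). K \<subseteq> T}"
    have VS: "V \<in> ?S" using ground_true_set[OF assms] K by blast
    then have "\<Inter>?S \<in> true_sets V (circular_cnf \<C>)"
      by (intro Inter_true_sets) blast+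
    then have "\<Inter>?S \<in> ?S" by blast
    then have "horn_closure V (circular_cnf \<C>) K = \<Inter>?S"
      unfolding horn_closure_def by (intro Least_equality) blast+
    moreover have "\<Inter>?S = V \<longleftrightarrow> (\<forall>T\<in>?S. T = V)"
    proof
      assume eq: "\<Inter>?S = V"
      show "\<forall>T\<in>?S. T = V"
      proof
        fix T assume T: "T \<in> ?S"
        then have "V \<subseteq> T" using eq by blast
        moreover have "T \<subseteq> V" using T unfolding true_sets_def by blast
        ultimately show "T = V" by blast
      qed
    qed (use VS in blast)
    ultimately have "horn_closure V (circular_cnf \<C>) K = V \<longleftrightarrow> (\<forall>T\<in>?S. T = V)" by simp
    then show ?thesis by auto
  qed
  then have "{K. K \<subseteq> V \<and> horn_closure V (circular_cnf \<C>) K = V} = Collect (spanning V \<C>)"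
    unfolding spanning_def by blast
  then show ?thesis unfolding minimal_keys_def by simp
qed

lemma minimal_keys_subset: "minimal_keys V h \<subseteq> Pow V"
  unfolding minimal_keys_def minimal_sets_def by blast

text \<open>The clause of \<open>C\<close> with head \<open>w\<close> puts \<open>w\<close> back
  into every true set above \<open>S - {w}\<close>.\<close>

lemma spanning_minus:
  assumes "spanning V \<C> S" "C \<in> \<C>" "w \<in> C" "C - {w} \<subseteq> S"
  shows "spanning V \<C> (S - {w})"
proof -
  have "T = V" if T: "T \<in> true_sets V (circular_cnf \<C>)" "S - {w} \<subseteq> T" for T
  proof -
    have "w \<in> T" using T assms unfolding true_sets_circular_cnf by blast
    then have "S \<subseteq> T" using T by blast
    then show ?thesis using T assms unfolding spanning_def by blast
  qed
  then show ?thesis using assms unfolding spanning_def by blast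
qed

text \<open>A subset of \<open>V\<close> contains no minimal key iff it does not span, that is, iff
  it lies in a proper true set. Hence the proper true sets are cofinal among the key-free sets, and
  both families have the same maximal members.\<close>

lemma maximal_proper_true_sets_eq:
  assumes V: "finite V" and C: "\<C> \<subseteq> Pow V"
  shows "maximal_proper_true_sets V (circular_cnf \<C>) =
    hyp_compl V (hyp_dual V (minimal_keys V (circular_cnf \<C>)))"
proof -
  let ?\<T> = "true_sets V (circular_cnf \<C>)"
  let ?S = "{S. S \<subseteq> V \<and> (\<forall>A\<in>minimal_keys V (circular_cnf \<C>). \<not> A \<subseteq> S)}"
  have fin: "finite (Collect (spanning V \<C>))"
    by (rule finite_subset[of _ "Pow V"]) (use V in \<open>auto simp: spanning_def\<close>)
  have key: "\<exists>A\<in>minimal_keys V (circular_cnf \<C>). A \<subseteq> S" if "spanning V \<C> S" for S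
  proof -
    have "S \<in> Collect (spanning V \<C>)" using that by simp
    with fin obtain A where "A \<in> minimal_sets (Collect (spanning V \<C>))" "A \<subseteq> S"
      by (rule minimal_sets_below)
    then show ?thesis unfolding minimal_keys_circular_cnf[OF C] by blast
  qed
  have S_iff: "S \<in> ?S \<longleftrightarrow> (\<exists>T\<in>?\<T> - {V}. S \<subseteq> T)" for S
  proof
    assume S: "S \<in> ?S"
    then have "\<not> spanning V \<C> S" using key[of S] by blast
    then show "\<exists>T\<in>?\<T> - {V}. S \<subseteq> T" using S unfolding spanning_def by blast
  next
    assume "\<exists>T\<in>?\<T> - {V}. S \<subseteq> T"
    then obtain T where T: "T \<in> ?\<T>" "T \<noteq> V" "S \<subseteq> T" by blast
    have "\<not> A \<subseteq> S" if "A \<in> minimal_keys V (circular_cnf \<C>)" for A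
    proof
      assume "A \<subseteq> S"
      then have "A \<subseteq> T" using T by blast
      moreover have "spanning V \<C> A"
        using that unfolding minimal_keys_circular_cnf[OF C] minimal_sets_def by blast
      ultimately show False using T unfolding spanning_def by blast
    qed
    moreover have "S \<subseteq> V" using T unfolding true_sets_def by blast
    ultimately show "S \<in> ?S" by blast
  qed
  have sub: "?\<T> - {V} \<subseteq> ?S"
  proof
    fix T assume "T \<in> ?\<T> - {V}"
    then show "T \<in> ?S" using S_iff[of T] by (meson order_refl)
  qed
  have "maximal_sets (?\<T> - {V}) = maximal_sets ?S"
    by (rule maximal_sets_cofinal[OF sub]) (rule S_iff[THEN iffD1])
  then show ?thesis
    unfolding maximal_proper_true_sets_def hyp_compl_hyp_dual[OF minimal_keys_subset] .
qed

section \<open>Bases\<close>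

definition independent :: "'a hypergraph \<Rightarrow> 'a set \<Rightarrow> bool" where
  "independent \<C> S \<longleftrightarrow> (\<forall>C\<in>\<C>. \<not> C \<subseteq> S)"

text \<open>The ground set is a parameter because the maximal independent subsets of a true set
  \<open>T\<close> are needed later, as \<open>bases T \<C>\<close>.\<close>

definition bases :: "'a set \<Rightarrow> 'a hypergraph \<Rightarrow> 'a hypergraph" where
  "bases V \<C> = maximal_sets {S. S \<subseteq> V \<and> independent \<C> S}"

lemma bases_eq: "\<C> \<subseteq> Pow V \<Longrightarrow> hyp_compl V (hyp_dual V \<C>) = bases V \<C>"
  unfolding hyp_compl_hyp_dual bases_def independent_def
  by (rule arg_cong[where f = maximal_sets]) blast

lemma bases_subset: "bases V \<C> \<subseteq> Pow V"
  unfolding bases_def maximal_sets_def by blast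

lemma independent_basis: "B \<in> bases V \<C> \<Longrightarrow> independent \<C> B"
  unfolding bases_def maximal_sets_def by blast

lemma basis_extension:
  assumes "finite V" "S \<subseteq> V" "independent \<C> S"
  obtains B where "B \<in> bases V \<C>" "S \<subseteq> B"
  using assms maximal_sets_above[of "{S. S \<subseteq> V \<and> independent \<C> S}" S]
  unfolding bases_def by auto

lemma basis_fundamental_circuit:
  assumes "B \<in> bases V \<C>" "v \<in> V - B"
  shows "\<exists>C\<in>\<C>. v \<in> C \<and> C - {v} \<subseteq> B"
proof -
  have "\<not> independent \<C> (insert v B)"
    using assms unfolding bases_def maximal_sets_def by blast
  then obtain C where "C \<in> \<C>" "C \<subseteq> insert v B" unfolding independent_def by blast
  moreover have "\<not> C \<subseteq> B" using independent_basis[OF assms(1)] calculation unfolding independent_def by blast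
  ultimately show ?thesis by blast
qed

text \<open>Each element outside \<open>B\<close> is forced by the clause of a hyperedge whose other
  elements lie in \<open>B\<close>; the circuit axiom is not involved.\<close>

lemma spanning_basis:
  assumes "B \<in> bases V \<C>"
  shows "spanning V \<C> B"
proof -
  have "v \<in> T" if "T \<in> true_sets V (circular_cnf \<C>)" "B \<subseteq> T" "v \<in> V" for T v
    using basis_fundamental_circuit[OF assms, of v] that unfolding true_sets_circular_cnf by blast
  then show ?thesis
    using assms bases_subset unfolding spanning_def true_sets_def by blast
qed

section \<open>The circuit axiom\<close>

text \<open>Induction on the size of the union. If plain elimination loses \<open>v\<close>, two
  further eliminations on smaller unions recover it: first \<open>x\<close> from \<open>C2\<close>
  and \<open>C3\<close> keeping \<open>u\<close>, then \<open>u\<close> from \<open>C1\<close> and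
  the result keeping \<open>v\<close>.\<close>

lemma strong_circuit_elimination:
  assumes "finite V" "\<C> \<subseteq> Pow V" "sperner \<C>" "circuit_elimination \<C>"
    and "C1 \<in> \<C>" "C2 \<in> \<C>" "u \<in> C1 \<inter> C2" "v \<in> C1 - C2"
  shows "\<exists>C3\<in>\<C>. v \<in> C3 \<and> C3 \<subseteq> (C1 \<union> C2) - {u}"
  using assms(5-)
proof (induction "card (C1 \<union> C2)" arbitrary: C1 C2 u v rule: less_induct)
  case less
  have fin: "finite (C1 \<union> C2)"
    using less.prems assms(1,2) by (meson PowD Un_least finite_subset subsetD)
  have "C1 \<noteq> C2" using less.prems by blast
  then obtain C3 where C3: "C3 \<in> \<C>" "C3 \<subseteq> (C1 \<union> C2) - {u}"
    using assms(4) less.prems unfolding circuit_elimination_def by meson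
  show ?case
  proof (cases "v \<in> C3")
    case True
    then show ?thesis using C3 by blast
  next
    case False
    \<comment> \<open>Otherwise \<open>C3 = C1\<close>, although \<open>C1\<close> contains
      \<open>u\<close> and \<open>C3\<close> does not.\<close>
    have "\<not> C3 \<subseteq> C1"
      using False C3 less.prems assms(3) unfolding sperner_def by blast
    then obtain x where x: "x \<in> C3" "x \<in> C2" "x \<notin> C1" using C3 by blast
    \<comment> \<open>The element \<open>v\<close> is missing from the smaller union.\<close>
    have "card (C2 \<union> C3) < card (C1 \<union> C2)"
      by (rule psubset_card_mono[OF fin]) (use False C3 less.prems in blast)
    then obtain C4 where C4: "C4 \<in> \<C>" "u \<in> C4" "C4 \<subseteq> (C2 \<union> C3) - {x}"
      using less.hyps[of C2 C3 x u] less.prems C3 x by blast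
    have "C1 \<union> C4 \<subseteq> C1 \<union> C2" "x \<notin> C1 \<union> C4" "x \<in> C1 \<union> C2"
      using C3 C4 x by blast+
    then have "card (C1 \<union> C4) < card (C1 \<union> C2)"
      by (intro psubset_card_mono[OF fin]) blast
    then obtain C5 where "C5 \<in> \<C>" "v \<in> C5" "C5 \<subseteq> (C1 \<union> C4) - {u}"
      using less.hyps[of C1 C4 u v] less.prems C3 C4 False by blast
    then show ?thesis using C3 C4 by blast
  qed
qed

text \<open>Given a clause with body in \<open>F\<close>, the elements of its circuit outside
  \<open>I\<close> other than the head \<open>v\<close> are eliminated one by one against the
  circuits that put them into \<open>F\<close>, keeping \<open>v\<close>. The induction measure
  counts these elements.\<close>

lemma matroid_closure_true_set:
  assumes "finite V" "\<C> \<subseteq> Pow V" "sperner \<C>" "circuit_elimination \<C>" "I \<subseteq> V"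
  defines "F \<equiv> I \<union> {v \<in> V. \<exists>C\<in>\<C>. v \<in> C \<and> C - {v} \<subseteq> I}"
  shows "F \<in> true_sets V (circular_cnf \<C>)"
proof -
  have "v \<in> F" if "C \<in> \<C>" "v \<in> C" "C - {v} \<subseteq> F" for C v
    using that
  proof (induction "card (C - insert v I)" arbitrary: C rule: less_induct)
    case less
    show ?case
    proof (cases "C - {v} \<subseteq> I")
      case True
      then show ?thesis using less.prems assms(2) unfolding F_def by blast
    next
      case False
      then obtain x where x: "x \<in> C" "x \<noteq> v" "x \<notin> I" by blast
      then obtain C' where C': "C' \<in> \<C>" "x \<in> C'" "C' - {x} \<subseteq> I"
        using less.prems unfolding F_def by blast
      show ?thesis
      proof (cases "v \<in> C'")
        case True
        then show ?thesis using C' x unfolding F_def by blast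
      next
        case False
        then obtain C3 where C3: "C3 \<in> \<C>" "v \<in> C3" "C3 \<subseteq> (C \<union> C') - {x}"
          using strong_circuit_elimination[OF assms(1-4), of C C' x v] less.prems x C' by blast
        have "finite (C - insert v I)"
          using less.prems assms(1,2) by (meson PowD finite_Diff finite_subset subsetD)
        \<comment> \<open>Elimination removes \<open>x\<close>, and everything that
          \<open>C'\<close> contributes besides \<open>x\<close> is already in
          \<open>I\<close>.\<close>
        moreover have "C3 - insert v I \<subset> C - insert v I"
          using C3 C' x by blast
        ultimately have "card (C3 - insert v I) < card (C - insert v I)"
          by (rule psubset_card_mono)
        moreover have "C3 - {v} \<subseteq> F"
          using C3 C' less.prems unfolding F_def by blast
        ultimately show ?thesis using less.hyps C3 by blast
      qed
    qed
  qed
  then show ?thesis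
    using assms(5) unfolding true_sets_circular_cnf F_def by blast
qed

lemma minimal_keys_eq_bases_iff:
  assumes V: "finite V" and C: "\<C> \<subseteq> Pow V" and ne: "{} \<notin> \<C>" and sp: "sperner \<C>"
  shows "minimal_keys V (circular_cnf \<C>) = bases V \<C> \<longleftrightarrow> circuit_elimination \<C>"
proof
  assume ce: "circuit_elimination \<C>"
  have basis_key: "B \<in> minimal_keys V (circular_cnf \<C>)" if B: "B \<in> bases V \<C>" for B
  proof -
    have "Y = B" if Y: "spanning V \<C> Y" "Y \<subseteq> B" for Y
    proof (rule ccontr)
      assume "Y \<noteq> B"
      then obtain b where b: "b \<in> B" "b \<notin> Y" using Y by blast
      let ?I = "B - {b}"
      let ?F = "?I \<union> {v \<in> V. \<exists>C\<in>\<C>. v \<in> C \<and> C - {v} \<subseteq> ?I}"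
      have "?F \<in> true_sets V (circular_cnf \<C>)"
        by (rule matroid_closure_true_set[OF V C sp ce]) (use B bases_subset in blast)
      moreover have "Y \<subseteq> ?F" using Y b by blast
      ultimately have FV: "?F = V" using Y unfolding spanning_def by blast
      \<comment> \<open>Since \<open>b\<close> is not in \<open>?I\<close>, it must have entered
        \<open>?F\<close> through a circuit whose other elements lie in \<open>?I\<close>; that
        circuit is contained in \<open>B\<close>.\<close>
      have "b \<in> V" using B b bases_subset by blast
      then have "b \<in> ?F" by (simp only: FV)
      then obtain C where "C \<in> \<C>" "C \<subseteq> B" using b by blast
      then show False using independent_basis[OF B] unfolding independent_def by blast
    qed
    then show ?thesis
      using spanning_basis[OF B] unfolding minimal_keys_circular_cnf[OF C] minimal_sets_def by blast
  qed
  moreover have "K \<in> bases V \<C>" if K: "K \<in> minimal_keys V (circular_cnf \<C>)" for K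
  proof -
    have span: "spanning V \<C> K" and min: "\<And>Y. spanning V \<C> Y \<Longrightarrow> Y \<subseteq> K \<Longrightarrow> Y = K"
      using K unfolding minimal_keys_circular_cnf[OF C] minimal_sets_def by blast+
    \<comment> \<open>A minimal key containing a hyperedge could drop any element \<open>w\<close>
      of it and still span.\<close>
    have "independent \<C> K"
      unfolding independent_def
    proof (intro ballI notI)
      fix D assume D: "D \<in> \<C>" "D \<subseteq> K"
      then have "D \<noteq> {}" using ne by metis
      then obtain w where w: "w \<in> D" by blast
      then have "spanning V \<C> (K - {w})" using spanning_minus[OF span] D by blast
      then show False using min w D by blast
    qed
    moreover have "K \<subseteq> V" using span unfolding spanning_def by blast
    ultimately obtain B where B: "B \<in> bases V \<C>" "K \<subseteq> B"
      using basis_extension[OF V] by blast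
    then show ?thesis
      using basis_key[OF B(1)] K sperner_minimal_sets
      unfolding minimal_keys_def sperner_def by metis
  qed
  ultimately show "minimal_keys V (circular_cnf \<C>) = bases V \<C>" by blast
next
  assume eq: "minimal_keys V (circular_cnf \<C>) = bases V \<C>"
  show "circuit_elimination \<C>"
    unfolding circuit_elimination_def
  proof (intro ballI impI)
    fix C1 C2 u assume C12: "C1 \<in> \<C>" "C2 \<in> \<C>" "C1 \<noteq> C2" "u \<in> C1 \<inter> C2"
    show "\<exists>C3\<in>\<C>. C3 \<subseteq> (C1 \<union> C2) - {u}"
    proof (rule ccontr)
      assume "\<not> ?thesis"
      then have "independent \<C> ((C1 \<union> C2) - {u})" unfolding independent_def by blast
      moreover have "(C1 \<union> C2) - {u} \<subseteq> V" using C C12 by blast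
      ultimately obtain B where B: "B \<in> bases V \<C>" "(C1 \<union> C2) - {u} \<subseteq> B"
        using basis_extension[OF V] by blast
      have "\<not> C1 \<subseteq> C2" using C12 sp unfolding sperner_def by metis
      then obtain w where w: "w \<in> C1" "w \<notin> C2" by blast
      have "\<not> C1 \<subseteq> B"
        using C12 independent_basis[OF B(1)] unfolding independent_def by blast
      have "u \<notin> B"
      proof
        assume "u \<in> B"
        then have "C1 \<subseteq> B" using B(2) by blast
        then show False using \<open>\<not> C1 \<subseteq> B\<close> by simp
      qed
      have "u \<in> V" using C C12 by blast
      then have "spanning V \<C> (insert u B)"
        using spanning_basis[OF B(1)] unfolding spanning_def by (metis insert_subset)
      \<comment> \<open>\<open>insert u B\<close> contains both circuits. Dropping \<open>w\<close>
        through \<open>C1\<close> leaves \<open>C2\<close> intact, so \<open>u\<close> can then be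
        dropped through \<open>C2\<close>.\<close>
      then have "spanning V \<C> (insert u B - {w})"
        by (rule spanning_minus[where C = C1]) (use C12 w B in blast)+
      then have "spanning V \<C> (insert u B - {w} - {u})"
        by (rule spanning_minus[where C = C2]) (use C12 w B in blast)+
      moreover have "insert u B - {w} - {u} = B - {w}" using \<open>u \<notin> B\<close> by blast
      ultimately have "spanning V \<C> (B - {w})" by simp
      moreover have "w \<in> B" using w B C12 by blast
      moreover have "\<And>Y. spanning V \<C> Y \<Longrightarrow> Y \<subseteq> B \<Longrightarrow> Y = B"
        using B(1) unfolding eq[symmetric] minimal_keys_circular_cnf[OF C] minimal_sets_def by blast
      ultimately show False by blast
    qed
  qed
qed

section \<open>True sets as intersections\<close>

lemma true_sets_eq_hyp_inters:
  assumes V: "finite V" and C: "\<C> \<subseteq> Pow V" and ne: "{} \<notin> \<C>"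
    and eq: "minimal_keys V (circular_cnf \<C>) = bases V \<C>"
  shows "true_sets V (circular_cnf \<C>) =
    hyp_inters V (maximal_proper_true_sets V (circular_cnf \<C>))"
proof -
  let ?\<T> = "true_sets V (circular_cnf \<C>)" and ?\<M> = "maximal_proper_true_sets V (circular_cnf \<C>)"
  have MT: "?\<M> \<subseteq> ?\<T>" unfolding maximal_proper_true_sets_def maximal_sets_def by blast
  have "finite ?\<T>"
    by (rule finite_subset[of _ "Pow V"]) (use V in \<open>auto simp: true_sets_def\<close>)
  have separate: "\<exists>M\<in>?\<M>. T \<subseteq> M \<and> v \<notin> M" if T: "T \<in> ?\<T>" and v: "v \<in> V - T" for T v
  proof -
    have TV: "T \<subseteq> V" using T unfolding true_sets_def by blast
    then have "finite T" using V finite_subset by blast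
    moreover have "{} \<subseteq> T" "independent \<C> {}" using ne unfolding independent_def by auto
    ultimately obtain I where I: "I \<in> bases T \<C>" using basis_extension by blast
    then have IT: "I \<subseteq> T" using bases_subset by blast
    \<comment> \<open>A hyperedge here would have head \<open>v\<close> and body inside the true set
      \<open>T\<close>, forcing \<open>v\<close> into \<open>T\<close>.\<close>
    have "independent \<C> (insert v I)"
      unfolding independent_def
    proof (intro ballI notI)
      fix D assume D: "D \<in> \<C>" "D \<subseteq> insert v I"
      then have "v \<in> D" using independent_basis[OF I] unfolding independent_def by blast
      then have "v \<in> T" using D IT T unfolding true_sets_circular_cnf by blast
      then show False using v by blast
    qed
    then obtain B where B: "B \<in> bases V \<C>" "insert v I \<subseteq> B"
      using basis_extension[OF V] IT TV v by (metis DiffD1 insert_subset subset_trans)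
    \<comment> \<open>By \<open>eq\<close>, the basis \<open>B\<close> is a minimal key, and it
      contains \<open>v\<close>.\<close>
    then have "\<not> spanning V \<C> (B - {v})"
      unfolding eq[symmetric] minimal_keys_circular_cnf[OF C] minimal_sets_def by blast
    then obtain T' where T': "T' \<in> ?\<T> - {V}" "B - {v} \<subseteq> T'"
      using B bases_subset unfolding spanning_def by blast
    then obtain M where M: "M \<in> ?\<M>" "T' \<subseteq> M"
      using maximal_sets_above[of "?\<T> - {V}" T'] \<open>finite ?\<T>\<close>
      unfolding maximal_proper_true_sets_def by auto
    have MT': "M \<in> ?\<T>" "M \<noteq> V"
      using M unfolding maximal_proper_true_sets_def maximal_sets_def by blast+
    have "v \<notin> M"
    proof
      assume "v \<in> M"
      then have "B \<subseteq> M" using T' M by blast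
      then show False using spanning_basis[OF B(1)] MT' unfolding spanning_def by blast
    qed
    have "I \<subseteq> M" using IT v B T' M by blast
    \<comment> \<open>\<open>I\<close> is a basis relative to the ground set \<open>T\<close>, so
      each remaining element of \<open>T\<close> is forced by a clause with body in
      \<open>I\<close>.\<close>
    have "T \<subseteq> M"
    proof
      fix t assume "t \<in> T"
      show "t \<in> M"
      proof (cases "t \<in> I")
        case False
        then obtain D where "D \<in> \<C>" "t \<in> D" "D - {t} \<subseteq> I"
          using basis_fundamental_circuit[OF I, of t] \<open>t \<in> T\<close> by blast
        then show ?thesis
          using MT' \<open>I \<subseteq> M\<close> unfolding true_sets_circular_cnf by blast
      qed (use \<open>I \<subseteq> M\<close> in blast)
    qed
    with M \<open>v \<notin> M\<close> show ?thesis by blast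
  qed
  show ?thesis
  proof (rule set_eqI, rule iffI)
    fix T assume T: "T \<in> ?\<T>"
    \<comment> \<open>For \<open>T = V\<close> the subfamily is empty and the factor
      \<open>V\<close> supplies the value.\<close>
    have "T = V \<inter> \<Inter>{M \<in> ?\<M>. T \<subseteq> M}"
      using separate[OF T] T unfolding true_sets_def by blast
    then show "T \<in> hyp_inters V ?\<M>" unfolding hyp_inters_def by blast
  next
    fix T assume "T \<in> hyp_inters V ?\<M>"
    \<comment> \<open>Inserting \<open>V\<close> makes the family nonempty, as
      \<open>Inter_true_sets\<close> requires.\<close>
    then obtain \<S> where S: "T = \<Inter>(insert V \<S>)" "\<S> \<subseteq> ?\<M>" unfolding hyp_inters_def by auto
    then show "T \<in> ?\<T>"
      using Inter_true_sets[of "insert V \<S>"] ground_true_set[OF C] MT by blast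
  qed
qed

theorem theorem5:
  fixes V :: "'a set" and \<C> :: "'a hypergraph" and h :: "'a boolean_function"
  assumes "finite V"
    and "\<C> \<subseteq> Pow V"
    and "nontrivial \<C>"
    and "sperner \<C>"
    and "h = circular_cnf \<C>"
  shows "(circuit_elimination \<C> \<longleftrightarrow>
            minimal_keys V h = hyp_compl V (hyp_dual V \<C>))
       \<and> (minimal_keys V h = hyp_compl V (hyp_dual V \<C>) \<longleftrightarrow>
            maximal_proper_true_sets V h =
              hyp_compl V (hyp_dual V (hyp_compl V (hyp_dual V \<C>))))
       \<and> (maximal_proper_true_sets V h =
              hyp_compl V (hyp_dual V (hyp_compl V (hyp_dual V \<C>))) \<longleftrightarrow>
            true_sets V h =
              hyp_inters V (hyp_compl V (hyp_dual V (hyp_compl V (hyp_dual V \<C>)))))"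
proof -
  note V = assms(1) and C = assms(2)
  have ne: "{} \<notin> \<C>" using assms(3) unfolding nontrivial_def by blast
  let ?B = "bases V \<C>" and ?D = "hyp_compl V (hyp_dual V (bases V \<C>))"
  have i_ii: "minimal_keys V h = ?B \<longleftrightarrow> circuit_elimination \<C>"
    using minimal_keys_eq_bases_iff[OF V C ne assms(4)] assms(5) by simp
  have M: "maximal_proper_true_sets V h = hyp_compl V (hyp_dual V (minimal_keys V h))"
    using maximal_proper_true_sets_eq[OF V C] assms(5) by simp
  have "sperner (minimal_keys V h)" "sperner ?B"
    unfolding minimal_keys_def bases_def
    by (rule sperner_minimal_sets, rule sperner_maximal_sets)
  \<comment> \<open>Both sides of (iii) are images under \<open>dc\<close> of Sperner hypergraphs,
    the minimal keys and the bases, so injectivity applies.\<close>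
  then have ii_iii: "minimal_keys V h = ?B \<longleftrightarrow> maximal_proper_true_sets V h = ?D"
    using hyp_compl_hyp_dual_inject[OF V minimal_keys_subset bases_subset] unfolding M by metis
  have iii_iv: "maximal_proper_true_sets V h = ?D \<longleftrightarrow> true_sets V h = hyp_inters V ?D"
  proof
    assume "maximal_proper_true_sets V h = ?D"
    then show "true_sets V h = hyp_inters V ?D"
      using true_sets_eq_hyp_inters[OF V C ne] ii_iii assms(5) by simp
  next
    assume "true_sets V h = hyp_inters V ?D"
    moreover have "maximal_sets (hyp_inters V ?D - {V}) = ?D"
    proof (rule maximal_sets_hyp_inters)
      note D = hyp_compl_hyp_dual[OF bases_subset, of V \<C>]
      show "sperner ?D" unfolding D by (rule sperner_maximal_sets)
      show "?D \<subseteq> Pow V" unfolding D maximal_sets_def by blast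
      \<comment> \<open>Members of \<open>?D\<close> contain no basis, whereas \<open>V\<close>
        contains one, obtained by extending the independent set \<open>{}\<close>.\<close>
      obtain B where "B \<in> ?B"
        using basis_extension[OF V, of "{}" \<C>] ne unfolding independent_def by auto
      moreover have "B \<subseteq> V" using bases_subset calculation by blast
      ultimately have "V \<notin> {S. S \<subseteq> V \<and> (\<forall>A\<in>?B. \<not> A \<subseteq> S)}" by blast
      then show "V \<notin> ?D" unfolding D maximal_sets_def by blast
    qed
    ultimately show "maximal_proper_true_sets V h = ?D"
      unfolding maximal_proper_true_sets_def by simp
  qed
  show ?thesis
    unfolding bases_eq[OF C] using i_ii ii_iii iii_iv by blast
qed

end
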